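(* Let $\mathbb{E}_1,\mathbb{E}_2$ be Euclidean spaces and let $F:D\to\mathbb{E}_2$ with $D\subset\mathbb{E}_1$ nonempty and convex. If the smallest closed convex cone $\hat K_F\subset\mathbb{E}_2$ with respect to which $F$ is both convex and closed exists, then $$-\hat K_F^\circ=\mathrm{cl}\{u\in\mathbb{E}_2 : \langle u,F\rangle\in\Gamma_0(\mathbb{E}_1)\}=\mathrm{cl}\{u\in\mathbb{E}_2 : \langle u,F\rangle\in\Gamma_0(D)\}.$$
   Context: A Euclidean space is a finite-dimensional real inner product space. A cone is a nonempty set $K$ with $\lambda x\in K$ for all $\lambda\ge0$, $x\in K$; its polar is $K^\circ:=\{v : \langle u,v\rangle\le0\ \forall u\in K\}$ and $-K^\circ$ is its dual cone. The $K$-epigraph of $F$ is $K\text{-}\mathrm{epi}\,F:=\{(x,y)\in D\times\mathbb{E}_2 : y-F(x)\in K\}$; $F$ is $K$-convex (convex w.r.t. $K$) if it is convex, $K$-closed (closed w.r.t. $K$) if it is closed in $\mathbb{E}_1\times\mathbb{E}_2$. $\hat K_F$, if it exists, is the closed convex cone such that $F$ is $\hat K_F$-convex and $\hat K_F$-closed and $\hat K_F\subset K$ for every closed convex cone $K$ for which $F$ is $K$-convex and $K$-closed (it exists as soon as one such $K$ exists). The scalarization $\langle u,F\rangle:\mathbb{E}_1\to\mathbb{R}\cup\{+\infty\}$ equals $\langle u,F(x)\rangle$ for $x\in D$ and $+\infty$ otherwise. $\Gamma_0(\mathbb{E}_1)$ is the set of proper, convex, lower semicontinuous functions $\mathbb{E}_1\to\mathbb{R}\cup\{+\infty\}$.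 For convex $D\subset\mathbb{E}_1$, $\Gamma_0(D)$ is the set of proper convex $f:\mathbb{E}_1\to\mathbb{R}\cup\{+\infty\}$ that are $D$-closed, i.e. $\mathrm{epi}\,f=\{(x,\alpha)\in\mathbb{E}_1\times\mathbb{R} : f(x)\le\alpha\}$ is closed in the subspace topology of $D\times\mathbb{R}$ (for functions with $\mathrm{dom}\,f=D$, as here: $\liminf_k f(x_k)\ge f(\bar x)$ whenever $x_k\in D$, $x_k\to\bar x\in D$). *)

theory Defs
  imports "HOL-Analysis.Analysis"
begin

(* A Euclidean space is a type of class real_inner satisfying this predicate. Unlike the class
   euclidean_space, whose Basis is nonempty, this allows dimension 0. *)
definition finite_dimensional :: "'a::real_inner itself \<Rightarrow> bool" where
  "finite_dimensional _ \<longleftrightarrow> (\<exists>B :: 'a set. finite B \<and> span B = UNIV)"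

definition polar_cone :: "'a::real_inner set \<Rightarrow> 'a set" where
  "polar_cone K = {v. \<forall>u\<in>K. u \<bullet> v \<le> 0}"

(* A map F : D -> E2 is a total function together with its domain D; the values of F outside D
   are never used. *)
definition K_epi ::
    "'b::real_inner set \<Rightarrow> 'a::real_inner set \<Rightarrow> ('a \<Rightarrow> 'b) \<Rightarrow> ('a \<times> 'b) set" where
  "K_epi K D F = {(x, y). x \<in> D \<and> y - F x \<in> K}"

definition K_convex ::
    "'b::real_inner set \<Rightarrow> 'a::real_inner set \<Rightarrow> ('a \<Rightarrow> 'b) \<Rightarrow> bool" where
  "K_convex K D F \<longleftrightarrow> convex (K_epi K D F)"

definition K_closed ::
    "'b::real_inner set \<Rightarrow> 'a::real_inner set \<Rightarrow> ('a \<Rightarrow> 'b) \<Rightarrow> bool" where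
  "K_closed K D F \<longleftrightarrow> closed (K_epi K D F)"

definition admissible_cone ::
    "'a::real_inner set \<Rightarrow> ('a \<Rightarrow> 'b::real_inner) \<Rightarrow> 'b set \<Rightarrow> bool" where
  "admissible_cone D F K \<longleftrightarrow>
     convex_cone K \<and> closed K \<and> K_convex K D F \<and> K_closed K D F"

(* Such a K is unique if it exists, by antisymmetry of inclusion. *)
definition smallest_cone ::
    "'a::real_inner set \<Rightarrow> ('a \<Rightarrow> 'b::real_inner) \<Rightarrow> 'b set \<Rightarrow> bool" where
  "smallest_cone D F K \<longleftrightarrow>
     admissible_cone D F K \<and> (\<forall>K'. admissible_cone D F K' \<longrightarrow> K \<subseteq> K')"

definition scalarization ::
    "'b::real_inner \<Rightarrow> 'a::real_inner set \<Rightarrow> ('a \<Rightarrow> 'b) \<Rightarrow> 'a \<Rightarrow> ereal" where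
  "scalarization u D F = (\<lambda>x. if x \<in> D then ereal (u \<bullet> F x) else \<infinity>)"

definition epi :: "('a \<Rightarrow> ereal) \<Rightarrow> ('a \<times> real) set" where
  "epi f = {(x, \<alpha>). f x \<le> ereal \<alpha>}"

(* Functions into the reals extended by +infinity are ereal-valued functions; properness
   excludes the value -infinity. *)
definition proper_fun :: "('a \<Rightarrow> ereal) \<Rightarrow> bool" where
  "proper_fun f \<longleftrightarrow> (\<forall>x. f x \<noteq> -\<infinity>) \<and> (\<exists>x. f x < \<infinity>)"

definition lower_semicontinuous :: "('a::topological_space \<Rightarrow> ereal) \<Rightarrow> bool" where
  "lower_semicontinuous f \<longleftrightarrow> (\<forall>x. f x \<le> Liminf (at x) f)"

definition Gamma0 :: "('a::real_inner \<Rightarrow> ereal) set" where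
  "Gamma0 = {f. proper_fun f \<and> convex (epi f) \<and> lower_semicontinuous f}"

(* closedin includes epi f being a subset of D x R, i.e. f is +infinity outside D. *)
definition Gamma0_on :: "'a::real_inner set \<Rightarrow> ('a \<Rightarrow> ereal) set" where
  "Gamma0_on D = {f. proper_fun f \<and> convex (epi f) \<and>
                     closedin (top_of_set (D \<times> UNIV)) (epi f)}"

end

theory Submission
  imports Defs
begin

text \<open>
  Write \<open>K\<^sup>*\<close> for the dual cone \<open>uminus ` polar_cone K\<close> and \<open>f\<^sub>u\<close> for \<open>scalarization u D F\<close>. Both
  equalities follow from the chain
  \<open>P \<subseteq> {u. f\<^sub>u \<in> Gamma0} \<subseteq> {u. f\<^sub>u \<in> Gamma0_on D} \<subseteq> K\<^sup>*\<close>,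
  where \<open>P\<close> is a dense subset of the closed set \<open>K\<^sup>*\<close>.

  The last inclusion is where minimality of \<open>K\<close> enters. If \<open>f\<^sub>u\<close> is convex and \<open>D\<close>-closed, then
  cutting \<open>K\<close> with the halfspace \<open>0 \<le> u \<bullet> k\<close> gives another admissible cone
  (\<open>admissible_cone_Int_halfspace\<close>): the limit points of its epigraph lie over \<open>D\<close> because they
  lie in the \<open>K\<close>-epigraph, so closedness relative to \<open>D\<close> is enough. By minimality \<open>K\<close> lies in the
  halfspace, i.e. \<open>u \<in> K\<^sup>*\<close>.

  For the first inclusion, \<open>P\<close> consists of those \<open>u \<in> K\<^sup>*\<close> that vanish on \<open>K\<close> only along the lineality
  space of \<open>K\<close>. Every \<open>u \<in> K\<^sup>*\<close> makes \<open>f\<^sub>u\<close> convex, but lower semicontinuity can fail: along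
  \<open>x\<^sub>n \<rightarrow> x\<close> with \<open>u \<bullet> F x\<^sub>n\<close> bounded above, \<open>F x\<^sub>n\<close> may escape to infinity. The escape happens in a
  recession direction of the closed convex \<open>K\<close>-epigraph, which is some \<open>z \<in> K\<close> with \<open>u \<bullet> z = 0\<close>; for
  \<open>u \<in> P\<close> it is a lineality direction, and replacing \<open>F x\<^sub>n\<close> by the shortest admissible vector over
  \<open>x\<^sub>n\<close> excludes it (\<open>closed_epi_scalarization\<close>). Finally \<open>P\<close> is nonempty by the bipolar theorem, and
  adding a small multiple of one of its members to any \<open>w \<in> K\<^sup>*\<close> gives a member of \<open>P\<close>, hence density.
\<close>

section \<open>Finite-dimensional inner product spaces\<close>

text \<open>
  Expanding in an orthogonal basis places the ball inside a coordinate box, and such a box is a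
  Minkowski sum of finitely many segments. Working with a basis covers the zero space, which
  type class \<^class>\<open>euclidean_space\<close> excludes.
\<close>

lemma finite_dimensional_compact_cball:
  fixes r :: real
  assumes "finite_dimensional TYPE('b::real_inner)"
  shows "compact (cball (0::'b) r)"
proof -
  obtain B :: "'b set" where B: "finite B" "span B = UNIV"
    using assms unfolding finite_dimensional_def by blast
  obtain C :: "'b set" where C: "finite C" "span C = UNIV" "pairwise orthogonal C"
    using basis_orthogonal[OF B(1)] B(2) by auto
  have expand: "x = (\<Sum>b\<in>C. (b \<bullet> x / (b \<bullet> b)) *\<^sub>R b)" for x
  proof -
    let ?d = "x - (\<Sum>b\<in>C. (b \<bullet> x / (b \<bullet> b)) *\<^sub>R b)"
    have "orthogonal ?d c" if c: "c \<in> C" for c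
    proof -
      have "(\<Sum>b\<in>C. (b \<bullet> x / (b \<bullet> b)) * (b \<bullet> c))
          = (\<Sum>b\<in>C. if b = c then c \<bullet> x else 0)"
        using C(3) c by (intro sum.cong) (auto simp: pairwise_def orthogonal_def)
      also have "\<dots> = x \<bullet> c" using C(1) c by (simp add: inner_commute)
      finally show ?thesis
        by (simp add: orthogonal_def inner_diff_left inner_sum_left)
    qed
    then have "orthogonal ?d ?d"
      using orthogonal_to_span[of ?d C ?d] C(2) by simp
    then show ?thesis by (simp add: orthogonal_def)
  qed
  (* The coefficient of b in the expansion of x is at most norm x / norm b. If b = 0, then
     division by zero makes both sides of this bound 0. *)
  let ?box = "\<lambda>A. {\<Sum>b\<in>A. f b *\<^sub>R b | f. \<forall>b\<in>A. \<bar>f b\<bar> \<le> r / norm b}"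
  have box: "compact (?box A)" if "finite A" for A :: "'b set"
    using that
  proof (induction A rule: finite_induct)
    case empty
    then show ?case by simp
  next
    case (insert a A)
    have "?box (insert a A) =
        {x + y | x y. x \<in> (\<lambda>t. t *\<^sub>R a) ` {- (r / norm a)..r / norm a} \<and> y \<in> ?box A}"
      (is "_ = ?S")
    proof (intro equalityI subsetI)
      fix z assume "z \<in> ?box (insert a A)"
      then obtain f where f: "z = (\<Sum>b\<in>insert a A. f b *\<^sub>R b)"
        "\<forall>b\<in>insert a A. \<bar>f b\<bar> \<le> r / norm b" by blast
      have "z = f a *\<^sub>R a + (\<Sum>b\<in>A. f b *\<^sub>R b)"
        using f(1) insert.hyps by simp
      moreover have "f a *\<^sub>R a \<in> (\<lambda>t. t *\<^sub>R a) ` {- (r / norm a)..r / norm a}"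
        using f(2) by (intro imageI) auto
      moreover have "(\<Sum>b\<in>A. f b *\<^sub>R b) \<in> ?box A" using f(2) by blast
      ultimately show "z \<in> ?S" by blast
    next
      fix z assume "z \<in> ?S"
      then obtain t f where tf: "z = t *\<^sub>R a + (\<Sum>b\<in>A. f b *\<^sub>R b)"
        "t \<in> {- (r / norm a)..r / norm a}" "\<forall>b\<in>A. \<bar>f b\<bar> \<le> r / norm b" by blast
      let ?g = "f(a := t)"
      have "(\<Sum>b\<in>A. ?g b *\<^sub>R b) = (\<Sum>b\<in>A. f b *\<^sub>R b)"
        using insert.hyps by (intro sum.cong) auto
      then have "z = (\<Sum>b\<in>insert a A. ?g b *\<^sub>R b)"
        using tf(1) insert.hyps by simp
      moreover have "\<forall>b\<in>insert a A. \<bar>?g b\<bar> \<le> r / norm b" using tf by auto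
      ultimately show "z \<in> ?box (insert a A)" by blast
    qed
    moreover have "compact ((\<lambda>t. t *\<^sub>R a) ` {- (r / norm a)..r / norm a})"
      by (intro compact_continuous_image continuous_intros compact_Icc)
    ultimately show ?case using compact_sums insert.IH by fastforce
  qed
  have "cball 0 r \<subseteq> ?box C"
  proof
    fix x :: 'b assume "x \<in> cball 0 r"
    then have x: "norm x \<le> r" by simp
    have "\<bar>b \<bullet> x / (b \<bullet> b)\<bar> \<le> r / norm b" for b
    proof (cases "b = 0")
      case False
      have "\<bar>b \<bullet> x\<bar> \<le> norm b * r"
        by (meson Cauchy_Schwarz_ineq2 mult_left_mono norm_ge_zero order_trans x)
      then have "\<bar>b \<bullet> x\<bar> / (norm b * norm b) \<le> norm b * r / (norm b * norm b)"
        by (intro divide_right_mono) auto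
      then show ?thesis using False
        by (simp add: abs_divide dot_square_norm power2_eq_square)
    qed simp
    then show "x \<in> ?box C"
      using expand[of x] by (intro CollectI exI[of _ "\<lambda>b. b \<bullet> x / (b \<bullet> b)"]) simp
  qed
  moreover have "compact (?box C \<inter> cball 0 r)"
    by (intro compact_Int_closed box C(1) closed_cball)
  ultimately show ?thesis by (simp add: Int_absorb1)
qed

lemma finite_dimensional_nearest_point:
  fixes S :: "'b::real_inner set"
  assumes "finite_dimensional TYPE('b)" and "closed S" and "S \<noteq> {}"
  obtains p where "p \<in> S" and "\<And>z. z \<in> S \<Longrightarrow> dist a p \<le> dist a z"
proof -
  obtain s where s: "s \<in> S" using assms(3) by blast
  let ?r = "norm a + dist a s"
  have far: "norm z \<le> ?r" if "dist a z \<le> dist a s" for z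
    using that norm_triangle_ineq4[of a "a - z"] by (simp add: dist_norm)
  have "compact (cball 0 ?r \<inter> S)"
    by (intro compact_Int_closed finite_dimensional_compact_cball assms)
  moreover have "cball 0 ?r \<inter> S \<noteq> {}" using s far[of s] by force
  moreover have "continuous_on (cball 0 ?r \<inter> S) (dist a)" by (intro continuous_intros)
  ultimately obtain p where p: "p \<in> cball 0 ?r \<inter> S"
    "\<And>z. z \<in> cball 0 ?r \<inter> S \<Longrightarrow> dist a p \<le> dist a z"
    using continuous_attains_inf[of "cball 0 ?r \<inter> S" "dist a"] by blast
  have "dist a p \<le> dist a z" if "z \<in> S" for z
  proof (cases "dist a z \<le> dist a s")
    case True
    then show ?thesis using p(2) far that by simp
  next
    case False
    then show ?thesis using p(2)[of s] far s by force
  qed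
  then show thesis using p that by blast
qed

section \<open>Dual cones\<close>

lemma mem_uminus_polar_cone: "u \<in> uminus ` polar_cone K \<longleftrightarrow> (\<forall>k\<in>K. 0 \<le> u \<bullet> k)"
proof
  show "\<forall>k\<in>K. 0 \<le> u \<bullet> k" if "u \<in> uminus ` polar_cone K"
    using that by (auto simp: polar_cone_def inner_commute)
  show "u \<in> uminus ` polar_cone K" if "\<forall>k\<in>K. 0 \<le> u \<bullet> k"
    using that by (intro image_eqI[of _ _ "- u"]) (auto simp: polar_cone_def inner_commute)
qed

lemma closed_uminus_polar_cone: "closed (uminus ` polar_cone K)"
proof -
  have "uminus ` polar_cone K = (\<Inter>k\<in>K. {u. 0 \<le> u \<bullet> k})"
    using mem_uminus_polar_cone[of _ K] by blast
  also have "closed \<dots>" by (intro closed_INT ballI closed_Collect_le continuous_intros)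
  finally show ?thesis .
qed

text \<open>
  The nontrivial half of the bipolar theorem. If \<open>p\<close> is the point of \<open>K\<close> nearest to \<open>y\<close>, then
  \<open>p - y\<close> lies in the dual cone and separates \<open>y\<close> from \<open>K\<close> unless \<open>y = p\<close>.
\<close>

lemma bidual_cone_subset:
  fixes K :: "'b::real_inner set"
  assumes fd: "finite_dimensional TYPE('b)" and K: "convex_cone K" "closed K"
    and y: "\<And>u. u \<in> uminus ` polar_cone K \<Longrightarrow> 0 \<le> u \<bullet> y"
  shows "y \<in> K"
proof -
  obtain p where p: "p \<in> K" "\<And>z. z \<in> K \<Longrightarrow> dist y p \<le> dist y z"
    using finite_dimensional_nearest_point[OF fd K(2) convex_cone_nonempty[OF K(1)]] by blast
  have obtuse: "(y - p) \<bullet> (k - p) \<le> 0" if "k \<in> K" for k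
    using any_closest_point_dot[of K p k y] K p that by (auto simp: convex_cone_def)
  have "(y - p) \<bullet> k \<le> 0" if "k \<in> K" for k
    using obtuse[of "p + k"] convex_cone_add[OF K(1) p(1) that] by simp
  then have "p - y \<in> uminus ` polar_cone K"
    unfolding mem_uminus_polar_cone by (auto simp: inner_diff_left)
  then have "(y - p) \<bullet> y \<le> 0" using y[of "p - y"] by (simp add: inner_diff_left)
  moreover have "0 \<le> (y - p) \<bullet> p"
    using obtuse[of 0] K(1) by (simp add: convex_cone_iff)
  ultimately have "(y - p) \<bullet> (y - p) \<le> 0" by (simp add: inner_diff_right)
  then have "(y - p) \<bullet> (y - p) = 0" by (intro antisym inner_ge_zero)
  then have "y = p" by simp
  then show ?thesis using p(1) by simp
qed

text \<open>
  For a closed convex cone in finite dimension these are the points of the relative interior of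
  the dual cone. The description through zeros on \<open>K\<close> is the form in which that condition controls
  recession directions of the epigraph.
\<close>

definition positive_modulo_lineality :: "'b::real_inner set \<Rightarrow> 'b \<Rightarrow> bool" where
  "positive_modulo_lineality K u \<longleftrightarrow>
     u \<in> uminus ` polar_cone K \<and> (\<forall>k\<in>K. u \<bullet> k = 0 \<longrightarrow> - k \<in> K)"

text \<open>
  The sum of a maximal independent set of dual vectors works: all its summands are nonnegative on
  \<open>K\<close>, so a zero of the sum is orthogonal to the span of the dual cone. The negative of the zero is
  then in the bidual cone, which is \<open>K\<close>.
\<close>

lemma positive_modulo_lineality_exists:
  fixes K :: "'b::real_inner set"
  assumes fd: "finite_dimensional TYPE('b)" and K: "convex_cone K" "closed K"
  obtains u where "positive_modulo_lineality K u"
proof -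
  obtain B :: "'b set" where B: "finite B" "span B = UNIV"
    using fd unfolding finite_dimensional_def by blast
  obtain C :: "'b set" where C: "C \<subseteq> uminus ` polar_cone K" "independent C"
    "uminus ` polar_cone K \<subseteq> span C"
    using maximal_independent_subset by blast
  have fin: "finite C" using independent_span_bound[OF B(1) C(2)] B(2) by simp
  have pos: "0 \<le> c \<bullet> k" if "c \<in> C" "k \<in> K" for c k
    using C(1) that mem_uminus_polar_cone by blast
  have "- k \<in> K" if k: "k \<in> K" "\<Sum>C \<bullet> k = 0" for k
  proof (rule bidual_cone_subset[OF fd K])
    fix v assume "v \<in> uminus ` polar_cone K"
    then have "v \<in> span C" using C(3) by blast
    moreover have "orthogonal k c" if "c \<in> C" for c
    proof -
      have "(\<Sum>c\<in>C. c \<bullet> k) = 0" using k(2) by (simp add: inner_sum_left)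
      then have "c \<bullet> k = 0"
        using sum_nonneg_eq_0_iff[of C "\<lambda>c. c \<bullet> k"] fin pos k(1) that by blast
      then show ?thesis by (simp add: orthogonal_def inner_commute)
    qed
    ultimately have "orthogonal k v" by (blast intro: orthogonal_to_span)
    then show "0 \<le> v \<bullet> - k" by (simp add: orthogonal_def inner_commute)
  qed
  moreover have "\<Sum>C \<in> uminus ` polar_cone K"
    unfolding mem_uminus_polar_cone by (auto simp: inner_sum_left intro: sum_nonneg pos)
  ultimately show thesis using that unfolding positive_modulo_lineality_def by blast
qed

text \<open>
  Adding a positive multiple of \<open>u\<^sub>0\<close> to a dual vector \<open>w\<close> only shrinks its zero set on \<open>K\<close>, since both
  \<open>w\<close> and \<open>u\<^sub>0\<close> are nonnegative there.
\<close>

lemma uminus_polar_cone_subset_closure_positive: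
  fixes K :: "'b::real_inner set"
  assumes "positive_modulo_lineality K u\<^sub>0"
  shows "uminus ` polar_cone K \<subseteq> closure {u. positive_modulo_lineality K u}"
proof
  fix w assume w: "w \<in> uminus ` polar_cone K"
  have pos: "0 \<le> w \<bullet> k" "0 \<le> u\<^sub>0 \<bullet> k" if "k \<in> K" for k
    using w assms that unfolding positive_modulo_lineality_def mem_uminus_polar_cone by auto
  define u where "u n = w + inverse (real (Suc n)) *\<^sub>R u\<^sub>0" for n
  have "positive_modulo_lineality K (u n)" for n
    unfolding positive_modulo_lineality_def mem_uminus_polar_cone
  proof (intro conjI ballI impI)
    fix k assume k: "k \<in> K"
    have expand: "u n \<bullet> k = w \<bullet> k + inverse (real (Suc n)) * (u\<^sub>0 \<bullet> k)"
      by (simp add: u_def inner_add_left)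
    have nonneg: "0 \<le> inverse (real (Suc n)) * (u\<^sub>0 \<bullet> k)"
      using pos(2)[OF k] by (intro mult_nonneg_nonneg) auto
    show "0 \<le> u n \<bullet> k" unfolding expand using pos(1)[OF k] nonneg by linarith
    assume "u n \<bullet> k = 0"
    then have "inverse (real (Suc n)) * (u\<^sub>0 \<bullet> k) = 0"
      unfolding expand using pos(1)[OF k] nonneg by linarith
    then have "u\<^sub>0 \<bullet> k = 0" by simp
    then show "- k \<in> K" using assms k unfolding positive_modulo_lineality_def by blast
  qed
  moreover have "u \<longlonglongrightarrow> w"
  proof -
    have "u \<longlonglongrightarrow> w + 0 *\<^sub>R u\<^sub>0"
      unfolding u_def by (intro tendsto_intros LIMSEQ_inverse_real_of_nat)
    then show ?thesis by simp
  qed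
  ultimately show "w \<in> closure {u. positive_modulo_lineality K u}"
    unfolding closure_sequential by blast
qed

section \<open>Epigraphs of scalarizations\<close>

lemma lower_semicontinuous_iff_closed_epi:
  fixes f :: "'a::topological_space \<Rightarrow> ereal"
  shows "lower_semicontinuous f \<longleftrightarrow> closed (epi f)"
proof
  assume lsc: "lower_semicontinuous f"
  have "\<exists>T. open T \<and> z \<in> T \<and> T \<subseteq> - epi f" if "z \<in> - epi f" for z
  proof -
    obtain x \<alpha> where z: "z = (x, \<alpha>)" by fastforce
    then have "ereal \<alpha> < f x" using that by (simp add: epi_def)
    then obtain c where c: "ereal \<alpha> < ereal c" "ereal c < f x" using ereal_dense2 by blast
    then have "\<forall>\<^sub>F x' in at x. ereal c < f x'"
      using lsc unfolding lower_semicontinuous_def le_Liminf_iff by blast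
    then obtain U where U: "open U" "x \<in> U" "\<forall>x'\<in>U. x' \<noteq> x \<longrightarrow> ereal c < f x'"
      unfolding eventually_at_topological by auto
    have "U \<times> {..<c} \<subseteq> - epi f"
    proof
      fix q assume "q \<in> U \<times> {..<c}"
      then obtain x' \<beta> where q: "q = (x', \<beta>)" "x' \<in> U" "\<beta> < c" by blast
      then have "ereal c < f x'" using U c by (cases "x' = x") auto
      with q have "ereal \<beta> < f x'" using less_trans[of "ereal \<beta>" "ereal c"] by simp
      with q show "q \<in> - epi f" by (simp add: epi_def)
    qed
    then show ?thesis using U c z by (intro exI[of _ "U \<times> {..<c}"]) (auto intro: open_Times)
  qed
  then show "closed (epi f)" unfolding closed_def by (subst open_subopen) blast
next
  assume closed: "closed (epi f)"
  show "lower_semicontinuous f"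
    unfolding lower_semicontinuous_def le_Liminf_iff
  proof (intro allI impI)
    fix x and y :: ereal assume "y < f x"
    then obtain c where c: "y < ereal c" "ereal c < f x" using ereal_dense2 by blast
    then have "(x, c) \<in> - epi f" by (simp add: epi_def)
    with closed obtain U V where UV: "open U" "x \<in> U" "c \<in> V" "U \<times> V \<subseteq> - epi f"
      unfolding closed_def by (elim open_prod_elim) blast+
    have "y < f x'" if "x' \<in> U" for x'
    proof -
      have "(x', c) \<in> - epi f" using UV that by blast
      then show ?thesis using c by (auto simp: epi_def intro: less_trans)
    qed
    then show "\<forall>\<^sub>F x' in at x. y < f x'"
      unfolding eventually_at_topological using UV by blast
  qed
qed

lemma mem_epi_scalarization:
  "(x, \<alpha>) \<in> epi (scalarization u D F) \<longleftrightarrow> x \<in> D \<and> u \<bullet> F x \<le> \<alpha>"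
  by (simp add: epi_def scalarization_def)

lemma proper_fun_scalarization: "D \<noteq> {} \<Longrightarrow> proper_fun (scalarization u D F)"
  unfolding proper_fun_def scalarization_def by auto

text \<open>
  The epigraph lies over \<open>D\<close>, so if it is closed in the whole space, it is closed relative to
  \<open>D \<times> UNIV\<close>.
\<close>

lemma Gamma0_scalarization_subset:
  "scalarization u D F \<in> Gamma0 \<Longrightarrow> scalarization u D F \<in> Gamma0_on D"
  unfolding Gamma0_def Gamma0_on_def lower_semicontinuous_iff_closed_epi
  by (auto intro!: closed_subset simp: mem_epi_scalarization)

lemma convex_epi_scalarization:
  fixes K :: "'b::real_inner set"
  assumes K: "convex_cone K" and F: "K_convex K D F" and u: "u \<in> uminus ` polar_cone K"
  shows "convex (epi (scalarization u D F))"
proof (rule convexI, clarify)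
  fix x \<alpha> y \<beta> and s t :: real
  assume st: "0 \<le> s" "0 \<le> t" "s + t = 1"
    and mem: "(x, \<alpha>) \<in> epi (scalarization u D F)" "(y, \<beta>) \<in> epi (scalarization u D F)"
  have 0: "0 \<in> K" using K by (simp add: convex_cone_iff)
  have "(x, F x) \<in> K_epi K D F" "(y, F y) \<in> K_epi K D F"
    using mem 0 by (auto simp: K_epi_def mem_epi_scalarization)
  then have "s *\<^sub>R (x, F x) + t *\<^sub>R (y, F y) \<in> K_epi K D F"
    using F st unfolding K_convex_def by (blast intro: convexD)
  then have in_D: "s *\<^sub>R x + t *\<^sub>R y \<in> D"
    and diff: "s *\<^sub>R F x + t *\<^sub>R F y - F (s *\<^sub>R x + t *\<^sub>R y) \<in> K"
    by (auto simp: K_epi_def)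
  have "u \<bullet> F (s *\<^sub>R x + t *\<^sub>R y) \<le> s * (u \<bullet> F x) + t * (u \<bullet> F y)"
    using u diff unfolding mem_uminus_polar_cone by (auto simp: inner_diff_right inner_add_right)
  also have "\<dots> \<le> s * \<alpha> + t * \<beta>"
    using mem st by (intro add_mono mult_left_mono) (auto simp: mem_epi_scalarization)
  finally show "s *\<^sub>R (x, \<alpha>) + t *\<^sub>R (y, \<beta>) \<in> epi (scalarization u D F)"
    using in_D by (simp add: mem_epi_scalarization)
qed

section \<open>Scalarizations and admissible cones\<close>

text \<open>
  The epigraph of the smaller cone is the \<open>K\<close>-epigraph intersected with the preimage of
  \<open>epi (scalarization u D F)\<close> under \<open>(x, y) \<mapsto> (x, u \<bullet> y)\<close>. The preimage need not be closed, but the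
  \<open>K\<close>-epigraph already confines \<open>x\<close> to \<open>D\<close>, so the preimage may be replaced by that of any closed set
  with the same trace on \<open>D \<times> UNIV\<close>.
\<close>

lemma admissible_cone_Int_halfspace:
  assumes adm: "admissible_cone D F K" and u: "scalarization u D F \<in> Gamma0_on D"
  shows "admissible_cone D F (K \<inter> {k. 0 \<le> u \<bullet> k})"
proof -
  let ?K = "K \<inter> {k. 0 \<le> u \<bullet> k}" and ?g = "\<lambda>(x, y). (x, u \<bullet> y)"
  have K: "convex_cone K" "closed K" "convex (K_epi K D F)" "closed (K_epi K D F)"
    using adm unfolding admissible_cone_def K_convex_def K_closed_def by auto
  have epi_eq: "K_epi ?K D F = K_epi K D F \<inter> ?g -` epi (scalarization u D F)"
    by (auto simp: K_epi_def mem_epi_scalarization inner_diff_right)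
  have "linear ?g"
    by (rule linearI) (auto simp: inner_add_right)
  then have "convex (K_epi ?K D F)"
    unfolding epi_eq using K(3) u
    by (intro convex_Int convex_linear_vimage) (auto simp: Gamma0_on_def)
  moreover obtain T where T: "closed T" "epi (scalarization u D F) = T \<inter> D \<times> UNIV"
    using u unfolding Gamma0_on_def closedin_closed by blast
  have "K_epi ?K D F = K_epi K D F \<inter> ?g -` T"
    unfolding epi_eq T(2) by (auto simp: K_epi_def)
  then have "closed (K_epi ?K D F)"
    using K(4) T(1)
    by (auto simp: case_prod_beta intro!: closed_Int closed_vimage continuous_intros)
  moreover have "convex_cone ?K"
    using K(1) by (auto simp: convex_cone_iff inner_add_right)
  moreover have "closed ?K"
    by (intro closed_Int K(2) closed_Collect_le continuous_intros)
  ultimately show ?thesis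
    unfolding admissible_cone_def K_convex_def K_closed_def by blast
qed

text \<open>
  Given points \<open>(X n, A n)\<close> of the epigraph with limit \<open>(x, \<alpha>)\<close>, let \<open>Y n\<close> be the shortest vector with
  \<open>(X n, Y n)\<close> in the \<open>K\<close>-epigraph and \<open>u \<bullet> Y n \<le> A n\<close>. If the \<open>Y n\<close> have a convergent subsequence, its
  limit is a vector over \<open>x\<close>, and closedness of the \<open>K\<close>-epigraph gives the claim. Otherwise their norms
  tend to infinity and a limit \<open>z\<close> of their directions is a unit vector of \<open>K\<close> with \<open>u \<bullet> z = 0\<close>.
  Then \<open>- z \<in> K\<close>, so the \<open>Y n\<close> can be shortened by subtracting multiples of \<open>z\<close>, contradicting their
  choice.
\<close>

lemma closed_epi_scalarization:
  fixes F :: "'a::real_inner \<Rightarrow> 'b::real_inner"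
  assumes fd: "finite_dimensional TYPE('b)"
    and adm: "admissible_cone D F K" and u: "positive_modulo_lineality K u"
  shows "closed (epi (scalarization u D F))"
  unfolding closed_sequential_limits
proof (intro allI impI, elim conjE)
  have K: "convex_cone K" "closed K" "convex (K_epi K D F)" "closed (K_epi K D F)"
    using adm unfolding admissible_cone_def K_convex_def K_closed_def by auto
  have zero: "0 \<in> K" using K(1) by (simp add: convex_cone_iff)
  have pos: "0 \<le> u \<bullet> k" if "k \<in> K" for k
    using u that unfolding positive_modulo_lineality_def mem_uminus_polar_cone by blast
  fix p :: "nat \<Rightarrow> 'a \<times> real" and q
  assume mem: "\<forall>n. p n \<in> epi (scalarization u D F)" and lim: "p \<longlonglongrightarrow> q"
  obtain x \<alpha> where q: "q = (x, \<alpha>)" by fastforce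
  define X where "X n = fst (p n)" for n
  define A where "A n = snd (p n)" for n
  have X: "X \<longlonglongrightarrow> x" and A: "A \<longlonglongrightarrow> \<alpha>"
    using lim q tendsto_fst[OF lim] tendsto_snd[OF lim] unfolding X_def A_def by auto
  have XA: "X n \<in> D" "u \<bullet> F (X n) \<le> A n" for n
    using mem[rule_format, of n] unfolding X_def A_def
    by (metis mem_epi_scalarization prod.collapse)+
  let ?S = "\<lambda>n. {y. (X n, y) \<in> K_epi K D F \<and> u \<bullet> y \<le> A n}"
  have "\<exists>y. y \<in> ?S n \<and> (\<forall>z\<in>?S n. norm y \<le> norm z)" for n
  proof -
    have eq: "?S n = Pair (X n) -` K_epi K D F \<inter> {y. u \<bullet> y \<le> A n}" by auto
    have closed: "closed (?S n)" unfolding eq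
      by (intro closed_Int closed_vimage K(4) closed_Collect_le continuous_intros)
    have "F (X n) \<in> ?S n" using XA zero by (simp add: K_epi_def)
    then have nonempty: "?S n \<noteq> {}" by blast
    obtain y where "y \<in> ?S n" "\<And>z. z \<in> ?S n \<Longrightarrow> dist 0 y \<le> dist 0 z"
      by (rule finite_dimensional_nearest_point[OF fd closed nonempty, where a = 0]) blast
    then show ?thesis by auto
  qed
  then have "\<exists>Y. \<forall>n. Y n \<in> ?S n \<and> (\<forall>z\<in>?S n. norm (Y n) \<le> norm z)"
    by (intro choice allI)
  then obtain Y where Y_mem: "\<And>n. Y n \<in> ?S n"
    and Y_min: "\<And>n z. z \<in> ?S n \<Longrightarrow> norm (Y n) \<le> norm z" by blast
  (* Rescaling by s treats both cases with one convergent subsequence of (s n, Z n): the limit of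
     s n is 0 exactly if norm (Y n) tends to infinity along it, and Z n then tends to a unit vector. *)
  define s where "s n = 1 / (1 + norm (Y n))" for n
  have s: "0 < s n" "s n \<le> 1" for n
    by (auto simp: s_def add_pos_nonneg divide_le_eq)
  define Z where "Z n = s n *\<^sub>R Y n" for n
  have norm_Z: "norm (Z n) = 1 - s n" for n
  proof -
    have "1 + norm (Y n) \<noteq> 0" using norm_ge_zero[of "Y n"] by linarith
    then show ?thesis unfolding Z_def s_def by (simp add: field_simps)
  qed
  have "compact ({0..1::real} \<times> cball (0::'b) 1)"
    by (intro compact_Times compact_Icc finite_dimensional_compact_cball fd)
  then have "seq_compact ({0..1::real} \<times> cball (0::'b) 1)"
    by (rule compact_imp_seq_compact)
  moreover have "\<forall>n. (s n, Z n) \<in> {0..1} \<times> cball 0 1"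
    using s norm_Z by (auto simp: less_imp_le)
  ultimately obtain l r where r: "strict_mono r" "((\<lambda>n. (s n, Z n)) \<circ> r) \<longlonglongrightarrow> l"
    by (rule seq_compactE)
  obtain \<sigma> z where l_eq: "l = (\<sigma>, z)" by fastforce
  have s_lim: "(\<lambda>n. s (r n)) \<longlonglongrightarrow> \<sigma>" and Z_lim: "(\<lambda>n. Z (r n)) \<longlonglongrightarrow> z"
    using tendsto_fst[OF r(2)] tendsto_snd[OF r(2)] l_eq by (auto simp: o_def)
  have X_lim: "(\<lambda>n. X (r n)) \<longlonglongrightarrow> x" and A_lim: "(\<lambda>n. A (r n)) \<longlonglongrightarrow> \<alpha>"
    using LIMSEQ_subseq_LIMSEQ[OF X r(1)] LIMSEQ_subseq_LIMSEQ[OF A r(1)] by (auto simp: o_def)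
  have Y_epi: "(X n, Y n) \<in> K_epi K D F" and Y_le: "u \<bullet> Y n \<le> A n" for n
    using Y_mem[of n] by auto
  have "\<sigma> \<noteq> 0"
  proof
    assume "\<sigma> = 0"
    with s_lim have s0: "(\<lambda>n. s (r n)) \<longlonglongrightarrow> 0" by simp
    have "(\<lambda>n. 1 - s (r n)) \<longlonglongrightarrow> 1 - 0" by (intro tendsto_intros s0)
    then have "norm z = 1"
      using LIMSEQ_unique[OF tendsto_norm[OF Z_lim]] by (simp add: norm_Z)
    have D: "X 0 \<in> D" using XA by simp
    (* Recession argument: segments from a fixed point to the escaping points (X n, Y n) stay in
       the convex epigraph and approach the fixed point shifted by (0, z). *)
    have "(X 0, F (X 0) + z) \<in> K_epi K D F"
    proof (rule closed_sequentially[OF K(4)])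
      let ?c = "\<lambda>n. (1 - s (r n)) *\<^sub>R (X 0, F (X 0)) + s (r n) *\<^sub>R (X (r n), Y (r n))"
      show "?c n \<in> K_epi K D F" for n
        using K(3) Y_epi s[of "r n"] D zero
        by (intro convexD) (auto simp: K_epi_def less_imp_le)
      have "(\<lambda>n. (1 - s (r n)) *\<^sub>R (X 0, F (X 0)) + (s (r n) *\<^sub>R X (r n), Z (r n)))
              \<longlonglongrightarrow> (1 - 0) *\<^sub>R (X 0, F (X 0)) + (0 *\<^sub>R x, z)"
        by (intro tendsto_intros s0 X_lim Z_lim)
      then show "?c \<longlonglongrightarrow> (X 0, F (X 0) + z)" by (simp add: Z_def)
    qed
    then have zK: "z \<in> K" by (simp add: K_epi_def)
    have "u \<bullet> z \<le> 0 * \<alpha>"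
    proof (rule LIMSEQ_le)
      show "(\<lambda>n. u \<bullet> Z (r n)) \<longlonglongrightarrow> u \<bullet> z" by (intro tendsto_intros Z_lim)
      show "(\<lambda>n. s (r n) * A (r n)) \<longlonglongrightarrow> 0 * \<alpha>" by (intro tendsto_intros s0 A_lim)
      show "\<exists>N. \<forall>n\<ge>N. u \<bullet> Z (r n) \<le> s (r n) * A (r n)"
        using s Y_le by (auto simp: Z_def intro!: mult_left_mono less_imp_le)
    qed
    then have uz: "u \<bullet> z = 0" using pos[OF zK] by simp
    then have mzK: "- z \<in> K" using u zK unfolding positive_modulo_lineality_def by blast
    (* Shortening Y n by z / s n, stated after rescaling by s n so that a limit can be taken. *)
    have min: "norm (Z n) \<le> norm (Z n - z)" for n
    proof -
      have "(1 / s n) *\<^sub>R (- z) \<in> K"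
        using s(1)[of n] by (intro convex_cone_scaleR[OF K(1)] mzK) simp
      moreover have "Y n - F (X n) \<in> K" using Y_epi by (simp add: K_epi_def)
      ultimately have "(Y n - F (X n)) + (1 / s n) *\<^sub>R (- z) \<in> K"
        using convex_cone_add[OF K(1)] by blast
      then have "Y n - (1 / s n) *\<^sub>R z \<in> ?S n"
        using XA Y_le[of n] uz by (simp add: K_epi_def inner_diff_right algebra_simps)
      then have "norm (Y n) \<le> norm (Y n - (1 / s n) *\<^sub>R z)" by (rule Y_min)
      then have "s n * norm (Y n) \<le> s n * norm (Y n - (1 / s n) *\<^sub>R z)"
        using s(1)[of n] by simp
      also have "\<dots> = norm (s n *\<^sub>R (Y n - (1 / s n) *\<^sub>R z))" using s(1)[of n] by simp
      also have "s n *\<^sub>R (Y n - (1 / s n) *\<^sub>R z) = Z n - z"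
        using s(1)[of n] by (simp add: Z_def scaleR_diff_right)
      finally show ?thesis using s(1)[of n] by (simp add: Z_def)
    qed
    have "norm z \<le> norm (z - z)"
      by (rule LIMSEQ_le[OF tendsto_norm[OF Z_lim]
            tendsto_norm[OF tendsto_diff[OF Z_lim tendsto_const]]]) (auto intro: min)
    then show False using \<open>norm z = 1\<close> by simp
  qed
  let ?y = "inverse \<sigma> *\<^sub>R z"
  have "Y n = inverse (s n) *\<^sub>R Z n" for n using s(1)[of n] by (simp add: Z_def)
  then have Y_lim: "(\<lambda>n. Y (r n)) \<longlonglongrightarrow> ?y"
    using \<open>\<sigma> \<noteq> 0\<close> by (auto intro!: tendsto_intros s_lim Z_lim)
  have "(x, ?y) \<in> K_epi K D F"
    by (rule closed_sequentially[OF K(4) _ tendsto_Pair[OF X_lim Y_lim]]) (rule Y_epi)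
  then have "x \<in> D" and "0 \<le> u \<bullet> (?y - F x)" using pos by (auto simp: K_epi_def)
  moreover have "u \<bullet> ?y \<le> \<alpha>"
    by (rule LIMSEQ_le[OF tendsto_inner[OF tendsto_const Y_lim] A_lim]) (auto intro: Y_le)
  ultimately show "q \<in> epi (scalarization u D F)"
    by (simp add: q mem_epi_scalarization inner_diff_right)
qed

theorem proposition27:
  fixes D :: "'a::real_inner set" and F :: "'a \<Rightarrow> 'b::real_inner" and K :: "'b set"
  assumes "finite_dimensional TYPE('a)" and "finite_dimensional TYPE('b)"
    and "D \<noteq> {}" and "convex D"
    and "smallest_cone D F K"
  shows "uminus ` polar_cone K = closure {u. scalarization u D F \<in> Gamma0}
         \<and> closure {u. scalarization u D F \<in> Gamma0}
           = closure {u. scalarization u D F \<in> Gamma0_on D}"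
proof -
  let ?G = "{u. scalarization u D F \<in> Gamma0}" and ?G\<^sub>D = "{u. scalarization u D F \<in> Gamma0_on D}"
  have adm: "admissible_cone D F K"
    and least: "\<And>K'. admissible_cone D F K' \<Longrightarrow> K \<subseteq> K'"
    using assms(5) unfolding smallest_cone_def by auto
  have K: "convex_cone K" "closed K" "K_convex K D F"
    using adm unfolding admissible_cone_def by auto
  obtain u\<^sub>0 where "positive_modulo_lineality K u\<^sub>0"
    using positive_modulo_lineality_exists[OF assms(2) K(1,2)] by blast
  then have "uminus ` polar_cone K \<subseteq> closure {u. positive_modulo_lineality K u}"
    by (rule uminus_polar_cone_subset_closure_positive)
  moreover have "{u. positive_modulo_lineality K u} \<subseteq> ?G"
  proof
    fix u assume "u \<in> {u. positive_modulo_lineality K u}"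
    then have u: "positive_modulo_lineality K u" by simp
    then have "convex (epi (scalarization u D F))"
      using convex_epi_scalarization[OF K(1,3)] unfolding positive_modulo_lineality_def by blast
    then show "u \<in> ?G"
      using closed_epi_scalarization[OF assms(2) adm u] proper_fun_scalarization[OF assms(3)]
      by (simp add: Gamma0_def lower_semicontinuous_iff_closed_epi)
  qed
  then have "closure {u. positive_modulo_lineality K u} \<subseteq> closure ?G" by (rule closure_mono)
  moreover have "closure ?G \<subseteq> closure ?G\<^sub>D"
    by (rule closure_mono) (auto intro: Gamma0_scalarization_subset)
  moreover have "?G\<^sub>D \<subseteq> uminus ` polar_cone K"
  proof
    fix u assume "u \<in> ?G\<^sub>D"
    then have "K \<subseteq> K \<inter> {k. 0 \<le> u \<bullet> k}"
      by (intro least admissible_cone_Int_halfspace[OF adm]) simp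
    then show "u \<in> uminus ` polar_cone K" unfolding mem_uminus_polar_cone by blast
  qed
  then have "closure ?G\<^sub>D \<subseteq> uminus ` polar_cone K"
    by (rule closure_minimal[OF _ closed_uminus_polar_cone])
  ultimately show ?thesis by (intro conjI equalityI) (meson order_trans)+
qed

end
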